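(* Let $\lambda$ be a nonzero real number, $k\in\mathbb{Z}$, and let $Y\sim\Gamma(1,1)$, i.e. $Y$ has density $e^{-y}$ for $y\ge0$ and $0$ for $y<0$. For every positive integer $n$, $$\mathrm{Bel}_{n,\lambda}^{(k,Y)}(x)=\sum_{m=1}^{n}\sum_{l=m}^{n}\frac{(1)_{m,\lambda}}{m^{k-1}}\lambda^{n-l}L(l,m)S_{1}(n,l)x^{m}.$$ In particular, $\mathrm{Bel}_{n,\lambda}^{(k,Y)}=\sum_{m=1}^{n}\sum_{l=m}^{n}\frac{(1)_{m,\lambda}}{m^{k-1}}\lambda^{n-l}L(l,m)S_{1}(n,l)$.
   Context: Degenerate falling factorial: $(x)_{0,\lambda}=1$, $(x)_{n,\lambda}=x(x-\lambda)\cdots(x-(n-1)\lambda)$ for $n\ge1$. Degenerate exponential: $e_\lambda^x(t)=(1+\lambda t)^{x/\lambda}=\sum_{n\ge0}(x)_{n,\lambda}\frac{t^n}{n!}$. For $k\in\mathbb{Z}$, $\mathrm{Ei}_{k,\lambda}(x)=\sum_{n=1}^{\infty}\frac{(1)_{n,\lambda}}{(n-1)!\,n^{k}}x^{n}$. The probabilistic degenerate poly-Bell polynomials $\mathrm{Bel}_{n,\lambda}^{(k,Y)}(x)$ are defined by $\mathrm{Ei}_{k,\lambda}\big(x(E[e_\lambda^Y(t)]-1)\big)=\sum_{n=1}^{\infty}\mathrm{Bel}_{n,\lambda}^{(k,Y)}(x)\frac{t^n}{n!}$ (power series in $t$), with $\mathrm{Bel}_{0,\lambda}^{(k,Y)}(x)=1$,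 and $\mathrm{Bel}_{n,\lambda}^{(k,Y)}=\mathrm{Bel}_{n,\lambda}^{(k,Y)}(1)$. $S_1(n,k)$ are the (signed) Stirling numbers of the first kind: $x(x-1)\cdots(x-n+1)=\sum_{k=0}^nS_1(n,k)x^k$. The Lah numbers are $L(n,k)=\frac{n!}{k!}\binom{n-1}{k-1}$, equivalently $\frac{1}{k!}\big(\frac{t}{1-t}\big)^k=\sum_{n\ge k}L(n,k)\frac{t^n}{n!}$. *)

theory Defs
  imports "HOL-Probability.Probability" "HOL-Computational_Algebra.Computational_Algebra"
begin

definition deg_falling :: "real \<Rightarrow> real \<Rightarrow> nat \<Rightarrow> real" where
  "deg_falling lam x n = (\<Prod>i<n. x - real i * lam)"

definition deg_exp :: "real \<Rightarrow> real \<Rightarrow> real fps" where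
  "deg_exp lam x = Abs_fps (\<lambda>n. deg_falling lam x n / fact n)"

text \<open>
  The expectation of the random power series \<open>deg_exp lam Y\<close> in \<open>t\<close>, taken coefficientwise.
  Lemma \<open>expectation_deg_exp_has_fps_expansion\<close> below shows that, as soon as \<open>Y\<close> has an
  exponential moment, this is the power series expansion at \<open>0\<close> of the function
  \<open>t \<mapsto> E[(1 + lam * t) powr (Y / lam)]\<close>.
\<close>

definition expectation_deg_exp :: "'a measure \<Rightarrow> ('a \<Rightarrow> real) \<Rightarrow> real \<Rightarrow> real fps" where
  "expectation_deg_exp M Y lam =
     Abs_fps (\<lambda>n. integral\<^sup>L M (\<lambda>\<omega>. fps_nth (deg_exp lam (Y \<omega>)) n))"

definition deg_Ei :: "int \<Rightarrow> real \<Rightarrow> real fps" where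
  "deg_Ei k lam =
     Abs_fps (\<lambda>n. if n = 0 then 0
                  else deg_falling lam 1 n / (fact (n - 1) * real n powi k))"

text \<open>
  The inner series of the composition has constant term \<open>0\<close> when \<open>M\<close> is a probability space,
  so the formal composition is the usual one.
\<close>

definition deg_poly_Bell ::
    "'a measure \<Rightarrow> ('a \<Rightarrow> real) \<Rightarrow> real \<Rightarrow> int \<Rightarrow> nat \<Rightarrow> real \<Rightarrow> real" where
  "deg_poly_Bell M Y lam k n x =
     (if n = 0 then 1
      else fact n *
        fps_nth (deg_Ei k lam oo (fps_const x * (expectation_deg_exp M Y lam - 1))) n)"

definition deg_poly_Bell_number ::
    "'a measure \<Rightarrow> ('a \<Rightarrow> real) \<Rightarrow> real \<Rightarrow> int \<Rightarrow> nat \<Rightarrow> real" where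
  "deg_poly_Bell_number M Y lam k n = deg_poly_Bell M Y lam k n 1"

text \<open>Signed, in contrast to the library function \<open>stirling\<close>.\<close>

definition Stirling1 :: "nat \<Rightarrow> nat \<Rightarrow> int" where
  "Stirling1 n k = poly.coeff (\<Prod>i<n. [:- int i, 1:]) k"

text \<open>
  The boundary cases follow the generating function \<open>(t / (1 - t)) ^ k / k!\<close>; the binomial
  formula would be wrong there because of truncated subtraction.
\<close>

definition Lah :: "nat \<Rightarrow> nat \<Rightarrow> real" where
  "Lah n k = (if n = 0 \<or> k = 0 then (if n = k then 1 else 0)
              else fact n / fact k * real ((n - 1) choose (k - 1)))"


lemma deg_falling_gchoose:
  assumes "lam \<noteq> 0"
  shows "deg_falling lam x n / fact n = (x / lam gchoose n) * lam ^ n"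
proof -
  have "deg_falling lam x n = (\<Prod>i<n. lam * (x / lam - real i))"
    unfolding deg_falling_def using assms by (intro prod.cong) (auto simp: field_simps)
  also have "\<dots> = lam ^ n * (\<Prod>i<n. x / lam - real i)"
    by (simp add: prod.distrib)
  finally show ?thesis
    by (simp add: gbinomial_prod_rev atLeast0LessThan)
qed

lemma deg_exp_sums:
  assumes "lam \<noteq> 0" "\<bar>lam * t\<bar> < 1"
  shows "(\<lambda>n. fps_nth (deg_exp lam x) n * t ^ n) sums (1 + lam * t) powr (x / lam)"
  using gen_binomial_real[OF assms(2), of "x / lam"] assms(1)
  by (simp add: deg_exp_def deg_falling_gchoose power_mult_distrib mult_ac)

lemma expectation_deg_exp_has_fps_expansion:
  fixes M :: "'a measure" and Y :: "'a \<Rightarrow> real" and lam r :: real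
  assumes "prob_space M" and Y[measurable]: "Y \<in> borel_measurable M"
    and lam: "lam \<noteq> 0" and r: "r > 0"
    and int: "integrable M (\<lambda>\<omega>. exp (r * \<bar>Y \<omega>\<bar>))"
  shows "(\<lambda>t. integral\<^sup>L M (\<lambda>\<omega>. (1 + lam * t) powr (Y \<omega> / lam)))
           has_fps_expansion expectation_deg_exp M Y lam"
proof -
  define s where "s = (1 - exp (- (r * \<bar>lam\<bar>))) / \<bar>lam\<bar>"
  have s: "s > 0" using lam r by (simp add: s_def)
  have lams: "1 - \<bar>lam\<bar> * s = exp (- (r * \<bar>lam\<bar>))" using lam by (simp add: s_def)
  have lams1: "\<bar>lam\<bar> * s < 1"
    using lams exp_gt_zero[of "- (r * \<bar>lam\<bar>)"] by linarith
  define c where "c = (\<lambda>n \<omega>. fps_nth (deg_exp lam (Y \<omega>)) n)"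
  define b where "b = (\<lambda>n \<omega>. fps_nth (deg_exp (- \<bar>lam\<bar>) \<bar>Y \<omega>\<bar>) n)"
  have c_meas[measurable]: "c n \<in> borel_measurable M" for n
    unfolding c_def deg_exp_def deg_falling_def by simp
  have cb: "\<bar>c n \<omega>\<bar> \<le> b n \<omega>" for n \<omega>
  proof -
    have "\<bar>deg_falling lam (Y \<omega>) n\<bar> \<le> deg_falling (- \<bar>lam\<bar>) \<bar>Y \<omega>\<bar> n"
      unfolding deg_falling_def abs_prod
    proof (intro prod_mono conjI)
      fix i
      have "\<bar>Y \<omega> - real i * lam\<bar> \<le> \<bar>Y \<omega>\<bar> + \<bar>real i * lam\<bar>" by (rule abs_triangle_ineq4)
      then show "\<bar>Y \<omega> - real i * lam\<bar> \<le> \<bar>Y \<omega>\<bar> - real i * - \<bar>lam\<bar>" by (simp add: abs_mult)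
    qed auto
    then show ?thesis unfolding c_def b_def deg_exp_def by (simp add: divide_right_mono)
  qed
  have b0: "b n \<omega> \<ge> 0" for n \<omega> using cb[of n \<omega>] by linarith
  have b_sums: "(\<lambda>n. b n \<omega> * s ^ n) sums exp (r * \<bar>Y \<omega>\<bar>)" for \<omega>
  proof -
    have "(\<lambda>n. b n \<omega> * s ^ n) sums (1 + (- \<bar>lam\<bar>) * s) powr (\<bar>Y \<omega>\<bar> / (- \<bar>lam\<bar>))"
      unfolding b_def using lam lams1 s by (intro deg_exp_sums) (auto simp: abs_mult)
    also have "1 + (- \<bar>lam\<bar>) * s = exp (- (r * \<bar>lam\<bar>))" using lams by simp
    also have "\<dots> powr (\<bar>Y \<omega>\<bar> / (- \<bar>lam\<bar>)) = exp (r * \<bar>Y \<omega>\<bar>)"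
      using lam by (simp add: powr_def)
    finally show ?thesis .
  qed
  have partial: "(\<Sum>i<n. \<bar>c i \<omega>\<bar> * s ^ i) \<le> exp (r * \<bar>Y \<omega>\<bar>)" for n \<omega>
  proof -
    have "(\<Sum>i<n. \<bar>c i \<omega>\<bar> * s ^ i) \<le> (\<Sum>i<n. b i \<omega> * s ^ i)"
      using s by (intro sum_mono mult_right_mono cb) auto
    also have "\<dots> \<le> exp (r * \<bar>Y \<omega>\<bar>)"
      using sum_le_suminf[OF sums_summable[OF b_sums[of \<omega>]], of "{..<n}"]
        sums_unique[OF b_sums[of \<omega>]] b0 s by simp
    finally show ?thesis .
  qed
  have ints: "integrable M (\<lambda>\<omega>. c n \<omega> * s ^ n)" for n
  proof (rule Bochner_Integration.integrable_bound[OF int])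
    show "AE \<omega> in M. norm (c n \<omega> * s ^ n) \<le> norm (exp (r * \<bar>Y \<omega>\<bar>))"
    proof (rule AE_I2)
      fix \<omega>
      have "\<bar>c n \<omega>\<bar> * s ^ n \<le> (\<Sum>i<Suc n. \<bar>c i \<omega>\<bar> * s ^ i)"
        using s by (simp add: sum_nonneg)
      also have "\<dots> \<le> exp (r * \<bar>Y \<omega>\<bar>)" by (rule partial)
      finally show "norm (c n \<omega> * s ^ n) \<le> norm (exp (r * \<bar>Y \<omega>\<bar>))"
        using s by (simp add: abs_mult)
    qed
  qed simp
  have intc: "integrable M (c n)" for n
    using ints[of n] s by simp
  have F: "fps_nth (expectation_deg_exp M Y lam) n = integral\<^sup>L M (c n)" for n
    unfolding expectation_deg_exp_def c_def by simp
  have summable_s: "summable (\<lambda>i. \<integral>\<omega>. \<bar>c i \<omega>\<bar> * s ^ i \<partial>M)"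
  proof (rule summableI_nonneg_bounded)
    show "0 \<le> (\<integral>\<omega>. \<bar>c i \<omega>\<bar> * s ^ i \<partial>M)" for i
      using s by (intro integral_nonneg_AE) auto
    fix n
    have "(\<Sum>i<n. \<integral>\<omega>. \<bar>c i \<omega>\<bar> * s ^ i \<partial>M) = (\<integral>\<omega>. (\<Sum>i<n. \<bar>c i \<omega>\<bar> * s ^ i) \<partial>M)"
      using intc by (intro Bochner_Integration.integral_sum[symmetric]) auto
    also have "\<dots> \<le> (\<integral>\<omega>. exp (r * \<bar>Y \<omega>\<bar>) \<partial>M)"
      using intc int partial
      by (intro integral_mono Bochner_Integration.integrable_sum) auto
    finally show "(\<Sum>i<n. \<integral>\<omega>. \<bar>c i \<omega>\<bar> * s ^ i \<partial>M) \<le> (\<integral>\<omega>. exp (r * \<bar>Y \<omega>\<bar>) \<partial>M)" .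
  qed
  have main: "(\<lambda>n. fps_nth (expectation_deg_exp M Y lam) n * t ^ n) sums
      integral\<^sup>L M (\<lambda>\<omega>. (1 + lam * t) powr (Y \<omega> / lam))" if t: "\<bar>t\<bar> \<le> s" for t
  proof -
    have ts: "\<bar>t\<bar> ^ i \<le> s ^ i" for i using t by (intro power_mono) auto
    have lt: "\<bar>lam * t\<bar> < 1"
    proof -
      have "\<bar>lam\<bar> * \<bar>t\<bar> \<le> \<bar>lam\<bar> * s" using t by (intro mult_left_mono) auto
      with lams1 show ?thesis by (simp add: abs_mult)
    qed
    have "(\<lambda>i. \<integral>\<omega>. c i \<omega> * t ^ i \<partial>M) sums (\<integral>\<omega>. (\<Sum>i. c i \<omega> * t ^ i) \<partial>M)"
    proof (rule sums_integral)
      show "integrable M (\<lambda>\<omega>. c i \<omega> * t ^ i)" for i using intc by simp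
      show "AE \<omega> in M. summable (\<lambda>i. norm (c i \<omega> * t ^ i))"
      proof (rule AE_I2)
        fix \<omega>
        have "norm (norm (c i \<omega> * t ^ i)) \<le> b i \<omega> * s ^ i" for i
          using mult_mono[OF cb[of i \<omega>] ts[of i] b0] by (simp add: abs_mult power_abs)
        then show "summable (\<lambda>i. norm (c i \<omega> * t ^ i))"
          by (intro summable_comparison_test[OF _ sums_summable[OF b_sums[of \<omega>]]]) auto
      qed
      show "summable (\<lambda>i. \<integral>\<omega>. norm (c i \<omega> * t ^ i) \<partial>M)"
      proof (rule summable_comparison_test[OF _ summable_s], intro exI allI impI)
        fix i
        have "norm (\<integral>\<omega>. norm (c i \<omega> * t ^ i) \<partial>M) = (\<integral>\<omega>. norm (c i \<omega> * t ^ i) \<partial>M)"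
          by simp
        also have "\<dots> \<le> (\<integral>\<omega>. \<bar>c i \<omega>\<bar> * s ^ i \<partial>M)"
          using intc[of i] ts[of i]
          by (intro integral_mono) (auto simp: abs_mult power_abs intro!: mult_left_mono)
        finally show "norm (\<integral>\<omega>. norm (c i \<omega> * t ^ i) \<partial>M) \<le> (\<integral>\<omega>. \<bar>c i \<omega>\<bar> * s ^ i \<partial>M)" .
      qed
    qed
    moreover have "(\<Sum>i. c i \<omega> * t ^ i) = (1 + lam * t) powr (Y \<omega> / lam)" for \<omega>
      unfolding c_def using deg_exp_sums[OF lam lt] by (rule sums_unique[symmetric])
    ultimately show ?thesis by (simp add: F)
  qed
  have "fps_conv_radius (expectation_deg_exp M Y lam) \<ge> norm s"
    unfolding fps_conv_radius_def
    using sums_summable[OF main[of s]] s by (intro conv_radius_geI) auto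
  then have rad: "fps_conv_radius (expectation_deg_exp M Y lam) > 0"
    using s by (metis abs_of_pos ereal_less(2) less_le_trans real_norm_def)
  have "eventually (\<lambda>z. z \<in> ball 0 s) (nhds (0::real))"
    using s by (intro eventually_nhds_in_open) auto
  then have "eventually (\<lambda>z. eval_fps (expectation_deg_exp M Y lam) z =
      integral\<^sup>L M (\<lambda>\<omega>. (1 + lam * z) powr (Y \<omega> / lam))) (nhds 0)"
  proof eventually_elim
    case (elim z)
    then show ?case
      unfolding eval_fps_def using main[of z] by (simp add: sums_iff)
  qed
  with rad show ?thesis by (simp add: has_fps_expansion_def)
qed

end

theory Submission
  imports Defs
begin

text \<open>
  Put \<open>u = log (1 + lam t) / lam\<close>, so that \<open>deg_exp lam y = exp (y u)\<close>. For the standard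
  exponential distribution \<open>E[Y ^ l] = l!\<close>, hence \<open>E[exp (Y u)] - 1 = u / (1 - u) = G \<circ> u\<close> with
  \<open>G = t / (1 - t)\<close>. The coefficients of \<open>G ^ m\<close> are Lah numbers and those of \<open>u ^ l\<close> are
  Stirling numbers of the first kind, so the coefficients of \<open>(G \<circ> u) ^ m = G ^ m \<circ> u\<close> are the
  inner sums of the theorem.
\<close>

lemma Stirling1_0 [simp]: "Stirling1 0 k = (if k = 0 then 1 else 0)"
  by (simp add: Stirling1_def)

lemma Stirling1_Suc_0 [simp]: "Stirling1 (Suc n) 0 = - int n * Stirling1 n 0"
  by (simp add: Stirling1_def mult.commute)

lemma Stirling1_Suc_Suc:
  "Stirling1 (Suc n) (Suc k) = Stirling1 n k - int n * Stirling1 n (Suc k)"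
  by (simp add: Stirling1_def mult.commute[of _ "[:_, _:]"])

lemma Stirling1_eq_0: "n < k \<Longrightarrow> Stirling1 n k = 0"
proof (induction n arbitrary: k)
  case (Suc n)
  then show ?case by (cases k) (auto simp: Stirling1_Suc_Suc)
qed simp

lemma prod_diff_eq_sum_Stirling1:
  fixes x :: "'a :: comm_ring_1"
  shows "(\<Prod>i<n. x - of_nat i) = (\<Sum>l\<le>n. of_int (Stirling1 n l) * x ^ l)"
proof (induction n)
  case (Suc n)
  let ?s = "\<lambda>l. of_int (Stirling1 n l) :: 'a"
  \<comment> \<open>The shifted sum runs up to exponent n + 1, where
    \<open>Stirling1 n (Suc n)\<close> is zero, so only the constant term is lost.\<close>
  have shift: "(\<Sum>l\<le>n. ?s (Suc l) * x ^ Suc l) = (\<Sum>l\<le>n. ?s l * x ^ l) - ?s 0"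
  proof -
    have "(\<Sum>l\<le>Suc n. ?s l * x ^ l) = (\<Sum>l\<le>n. ?s l * x ^ l)"
      by (simp add: Stirling1_eq_0)
    then show ?thesis
      by (subst (asm) sum.atMost_Suc_shift) (simp add: algebra_simps)
  qed
  have "(\<Sum>l\<le>Suc n. of_int (Stirling1 (Suc n) l) * x ^ l) =
      - of_nat n * ?s 0 + (\<Sum>l\<le>n. ?s l * x ^ Suc l - of_nat n * (?s (Suc l) * x ^ Suc l))"
    by (subst sum.atMost_Suc_shift) (simp add: Stirling1_Suc_Suc algebra_simps)
  also have "\<dots> = (x - of_nat n) * (\<Sum>l\<le>n. ?s l * x ^ l)"
    unfolding sum_subtractf sum_distrib_left[symmetric] shift
    unfolding power_Suc mult.left_commute[of _ x] sum_distrib_left[symmetric]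
    by (simp add: left_diff_distrib right_diff_distrib)
  finally show ?case using Suc.IH by (simp add: mult.commute)
qed simp

text \<open>Dividing \<open>y\<close> by \<open>lam\<close> reduces to the ordinary falling
  factorial. Writing \<open>lam ^ n / lam ^ l\<close> keeps truncated subtraction out of the
  calculations.\<close>

lemma deg_falling_eq_sum_Stirling1:
  assumes "lam \<noteq> 0"
  shows "deg_falling lam y n = (\<Sum>l\<le>n. lam ^ n / lam ^ l * of_int (Stirling1 n l) * y ^ l)"
proof -
  have "deg_falling lam y n = (\<Prod>i<n. lam * (y / lam - real i))"
    unfolding deg_falling_def using assms by (intro prod.cong) (auto simp: field_simps)
  also have "\<dots> = lam ^ n * (\<Sum>l\<le>n. of_int (Stirling1 n l) * (y / lam) ^ l)"
    by (simp add: prod.distrib prod_diff_eq_sum_Stirling1)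
  finally show ?thesis
    by (simp add: sum_distrib_left power_divide mult_ac)
qed

text \<open>The Taylor series at 0 of log (1 + lam t) / lam, the \<open>u\<close> of the
  overview.\<close>

definition deg_log :: "real \<Rightarrow> real fps" where
  "deg_log lam = Abs_fps (\<lambda>n. if n = 0 then 0 else (- lam) ^ (n - 1) / real n)"

lemma deg_log_nth_0 [simp]: "fps_nth (deg_log lam) 0 = 0"
  by (simp add: deg_log_def)

lemma deg_log_deriv: "(1 + fps_const lam * fps_X) * fps_deriv (deg_log lam) = 1"
proof -
  have "fps_deriv (deg_log lam) = Abs_fps (\<lambda>n. (- lam) ^ n)"
    by (rule fps_ext) (simp add: deg_log_def del: of_nat_Suc)
  moreover have "fps_nth ((1 + fps_const lam * fps_X) * Abs_fps (\<lambda>n. (- lam) ^ n)) n = fps_nth 1 n"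
    for n
    by (cases n) (simp_all add: distrib_right mult.assoc)
  ultimately show ?thesis by (metis fps_ext)
qed

text \<open>The chain rule with u' = 1 / (1 + lam t). Clearing the denominator makes the equation a
  recurrence for the coefficients of the powers of u.\<close>

lemma deg_log_power_deriv:
  "(1 + fps_const lam * fps_X) * fps_deriv (deg_log lam ^ Suc l) =
     of_nat (Suc l) * deg_log lam ^ l"
proof -
  have "(1 + fps_const lam * fps_X) * fps_deriv (deg_log lam ^ Suc l) =
      of_nat (Suc l) * deg_log lam ^ l *
        ((1 + fps_const lam * fps_X) * fps_deriv (deg_log lam))"
    by (subst fps_deriv_power) (simp add: mult_ac fps_of_nat[symmetric] del: of_nat_Suc)
  then show ?thesis by (simp only: deg_log_deriv mult_1_right)
qed

text \<open>Comparing coefficients in \<open>deg_log_power_deriv\<close> gives, up to normalisation,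
  the recurrence \<open>Stirling1_Suc_Suc\<close>. It lowers the exponent as well, hence the
  arbitrary \<open>l\<close>.\<close>

lemma deg_log_power_nth:
  assumes "lam \<noteq> 0"
  shows "fps_nth (deg_log lam ^ l) n =
     fact l * (lam ^ n / lam ^ l) * of_int (Stirling1 n l) / fact n"
proof (induction n arbitrary: l)
  case 0
  then show ?case by (simp add: fps_power_zeroth)
next
  case (Suc n)
  show ?case
  proof (cases l)
    case 0
    \<comment> \<open>Exponent 0 lies outside the recurrence: the power is 1, so its coefficient at
      \<open>Suc n\<close> is zero.\<close>
    have "Stirling1 (Suc n) 0 = 0"
      by (induction n) simp_all
    then show ?thesis using 0 by (simp del: Stirling1_Suc_0)
  next
    case l: (Suc j)
    have eq: "real (Suc n) * fps_nth (deg_log lam ^ Suc j) (Suc n)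
        + lam * (real n * fps_nth (deg_log lam ^ Suc j) n)
        = real (Suc j) * fps_nth (deg_log lam ^ j) n"
    proof -
      have "fps_nth ((1 + fps_const lam * fps_X) * fps_deriv (deg_log lam ^ Suc j)) n =
          fps_nth (fps_const (real (Suc j)) * deg_log lam ^ j) n"
        by (simp only: deg_log_power_deriv fps_of_nat)
      then show ?thesis
        by (cases n) (simp_all add: distrib_right mult.assoc del: power_Suc)
    qed
    have "real (Suc n) * fps_nth (deg_log lam ^ Suc j) (Suc n) =
        real (Suc j) * (fact j * (lam ^ n / lam ^ j) * of_int (Stirling1 n j) / fact n)
        - lam * (real n * (fact (Suc j) * (lam ^ n / lam ^ Suc j)
            * of_int (Stirling1 n (Suc j)) / fact n))"
      using eq unfolding Suc.IH by linarith
    also have "\<dots> = fact (Suc j) * (lam ^ n / lam ^ j) * of_int (Stirling1 (Suc n) (Suc j)) / fact n"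
      using assms by (simp add: Stirling1_Suc_Suc field_simps)
    finally show ?thesis
      using assms l by (simp add: field_simps del: of_nat_Suc)
  qed
qed

definition geometric_fps :: "real fps" where
  "geometric_fps = Abs_fps (\<lambda>n. if n = 0 then 0 else 1)"

lemma geometric_fps_mult: "(1 - fps_X) * geometric_fps = fps_X"
proof (rule fps_ext)
  fix n
  show "fps_nth ((1 - fps_X) * geometric_fps) n = fps_nth fps_X n"
    by (cases n) (auto simp: geometric_fps_def left_diff_distrib)
qed

text \<open>With G = t / (1 - t), the identity (1 - t) G^(j+1) = t G^j gives a recurrence for the
  coefficients. For l, m \<ge> 1 the right-hand side is the binomial
  \<open>(l - 1) choose (m - 1)\<close>, and the recurrence is Pascal's rule.\<close>

lemma geometric_fps_power_nth: "fps_nth (geometric_fps ^ m) l = fact m * Lah l m / fact l"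
proof (induction l arbitrary: m)
  case 0
  then show ?case by (simp add: fps_power_zeroth geometric_fps_def Lah_def)
next
  case (Suc l)
  show ?case
  proof (cases m)
    case 0
    then show ?thesis by (simp add: Lah_def)
  next
    case m: (Suc j)
    have "(1 - fps_X) * geometric_fps ^ Suc j = fps_X * geometric_fps ^ j"
      using geometric_fps_mult by (simp add: mult.assoc[symmetric])
    from arg_cong[OF this, of "\<lambda>f. fps_nth f (Suc l)"]
    have "fps_nth (geometric_fps ^ Suc j) (Suc l) =
        fps_nth (geometric_fps ^ Suc j) l + fps_nth (geometric_fps ^ j) l"
      by (simp add: left_diff_distrib del: power_Suc)
    \<comment> \<open>The cases l = 0 and j = 0 are separated because they meet the boundary values
      of \<open>Lah\<close>.\<close>
    also have "\<dots> = fact (Suc j) * Lah (Suc l) (Suc j) / fact (Suc l)"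
      unfolding Suc.IH by (cases l; cases j) (auto simp: Lah_def)
    finally show ?thesis using m by simp
  qed
qed

text \<open>Each coefficient is a polynomial in \<open>Y\<close>, so finite linearity and the
  moments suffice; no infinite sum is exchanged with the expectation.\<close>

lemma expectation_deg_exp_exponential:
  assumes "prob_space M"
    and D: "distributed M lborel Y (\<lambda>y. ennreal (if y \<ge> 0 then exp (- y) else 0))"
    and lam: "lam \<noteq> 0"
  shows "expectation_deg_exp M Y lam - 1 = geometric_fps oo deg_log lam"
proof (rule fps_ext)
  fix n
  interpret prob_space M by fact
  \<comment> \<open>The first argument of \<open>erlang_density\<close> is the shape minus one, so 0
    stands for shape 1.\<close>
  have D': "distributed M lborel Y (erlang_density 0 1)"
  proof -
    have "(\<lambda>y. ennreal (if y \<ge> 0 then exp (- y) else 0)) = (\<lambda>y. ennreal (erlang_density 0 1 y))"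
      by (auto simp: erlang_density_def)
    with D show ?thesis by simp
  qed
  have moment: "expectation (\<lambda>\<omega>. Y \<omega> ^ i) = fact i" for i
    using erlang_ith_moment[OF _ D', of i] by simp
  have [simp]: "integrable M (\<lambda>\<omega>. Y \<omega> ^ i)" for i
    using erlang_ith_moment_integrable[OF _ D', of i] by simp
  have "fps_nth (expectation_deg_exp M Y lam) n =
      (\<integral>\<omega>. (\<Sum>l\<le>n. lam ^ n / lam ^ l * of_int (Stirling1 n l) * Y \<omega> ^ l) / fact n \<partial>M)"
    by (simp add: expectation_deg_exp_def deg_exp_def deg_falling_eq_sum_Stirling1[OF lam])
  also have "\<dots> = (\<Sum>l\<le>n. lam ^ n / lam ^ l * of_int (Stirling1 n l) * fact l) / fact n"
    by (simp add: Bochner_Integration.integral_sum moment del: times_divide_eq_left)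
  \<comment> \<open>The moment l! is exactly the factor l! in the coefficients of
    \<open>deg_log lam ^ l\<close>.\<close>
  also have "\<dots> = (\<Sum>l\<le>n. fps_nth (deg_log lam ^ l) n)"
    by (simp add: deg_log_power_nth[OF lam] sum_divide_distrib mult_ac)
  \<comment> \<open>The power l = 0 yields the 1 that the claim subtracts; every l \<ge> 1 has
    coefficient 1 in \<open>geometric_fps\<close>.\<close>
  also have "\<dots> = fps_nth 1 n + (\<Sum>l=0..n. fps_nth geometric_fps l * fps_nth (deg_log lam ^ l) n)"
  proof -
    have "(\<Sum>l\<le>n. fps_nth (deg_log lam ^ l) n) =
        (\<Sum>l\<le>n. (if l = 0 then fps_nth 1 n else 0)
           + fps_nth geometric_fps l * fps_nth (deg_log lam ^ l) n)"
      by (intro sum.cong) (auto simp: geometric_fps_def)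
    then show ?thesis by (simp add: sum.distrib atLeast0AtMost)
  qed
  finally show "fps_nth (expectation_deg_exp M Y lam - 1) n =
      fps_nth (geometric_fps oo deg_log lam) n"
    by (simp add: fps_compose_nth)
qed

lemma deg_poly_Bell_exponential:
  assumes M: "prob_space M"
    and D: "distributed M lborel Y (\<lambda>y. ennreal (if y \<ge> 0 then exp (- y) else 0))"
    and lam: "lam \<noteq> 0"
    and n: "n \<ge> 1"
  shows "deg_poly_Bell M Y lam k n x =
            (\<Sum>m=1..n. \<Sum>l=m..n. deg_falling lam 1 m / real m powi (k - 1)
               * lam ^ (n - l) * Lah l m * of_int (Stirling1 n l) * x ^ m)"
proof -
  have pow: "fps_nth ((geometric_fps oo deg_log lam) ^ m) n =
      (\<Sum>l=m..n. fact m * Lah l m * lam ^ (n - l) * of_int (Stirling1 n l)) / fact n"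
    if "m \<ge> 1" for m
  proof -
    \<comment> \<open>Powers commute with composition, and the l! of the Stirling coefficients
      cancels the 1 / l! of the Lah coefficients.\<close>
    have "fps_nth ((geometric_fps oo deg_log lam) ^ m) n =
        (\<Sum>l=0..n. fact m * Lah l m * (lam ^ n / lam ^ l) * of_int (Stirling1 n l) / fact n)"
      by (simp add: fps_compose_power fps_compose_nth geometric_fps_power_nth
          deg_log_power_nth[OF lam] mult.assoc)
    \<comment> \<open>\<open>Lah l m\<close> vanishes for l < m: at l = 0 by the boundary clause,
      otherwise through the binomial.\<close>
    also have "\<dots> = (\<Sum>l=m..n. fact m * Lah l m * (lam ^ n / lam ^ l) * of_int (Stirling1 n l) / fact n)"
      using that by (intro sum.mono_neutral_right) (auto simp: Lah_def)
    also have "\<dots> = (\<Sum>l=m..n. fact m * Lah l m * lam ^ (n - l) * of_int (Stirling1 n l) / fact n)"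
      using lam by (intro sum.cong) (auto simp: power_diff)
    finally show ?thesis by (simp add: sum_divide_distrib)
  qed
  \<comment> \<open>The m! comes from the Lah coefficients; over (m - 1)! it leaves one factor m,
    which turns the exponent k into k - 1.\<close>
  have coeff: "fact m / (fact (m - 1) * real m powi k) = 1 / real m powi (k - 1)" if "m \<ge> 1" for m
    using that by (simp add: fact_reduce[of m] power_int_diff)
  have "deg_poly_Bell M Y lam k n x =
      fact n * (\<Sum>m=0..n. fps_nth (deg_Ei k lam) m *
        (x ^ m * fps_nth ((geometric_fps oo deg_log lam) ^ m) n))"
    using n by (simp add: deg_poly_Bell_def expectation_deg_exp_exponential[OF M D lam]
        fps_compose_nth power_mult_distrib fps_const_power)
  also have "\<dots> = fact n * (\<Sum>m=1..n. fps_nth (deg_Ei k lam) m *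
        (x ^ m * fps_nth ((geometric_fps oo deg_log lam) ^ m) n))"
    by (intro arg_cong2[where f = "(*)"] sum.mono_neutral_right) (auto simp: deg_Ei_def)
  also have "\<dots> = (\<Sum>m=1..n. deg_falling lam 1 m * (fact m / (fact (m - 1) * real m powi k)) * x ^ m *
        (\<Sum>l=m..n. Lah l m * lam ^ (n - l) * of_int (Stirling1 n l)))"
    unfolding sum_distrib_left[of "fact n"]
  proof (intro sum.cong refl)
    fix m assume "m \<in> {1..n}"
    then show "fact n * (fps_nth (deg_Ei k lam) m *
        (x ^ m * fps_nth ((geometric_fps oo deg_log lam) ^ m) n)) =
      deg_falling lam 1 m * (fact m / (fact (m - 1) * real m powi k)) * x ^ m *
        (\<Sum>l=m..n. Lah l m * lam ^ (n - l) * of_int (Stirling1 n l))"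
      by (simp add: pow deg_Ei_def mult.assoc sum_distrib_left[symmetric])
  qed
  also have "\<dots> = (\<Sum>m=1..n. \<Sum>l=m..n. deg_falling lam 1 m / real m powi (k - 1)
               * lam ^ (n - l) * Lah l m * of_int (Stirling1 n l) * x ^ m)"
    by (intro sum.cong refl, subst coeff) (simp_all add: sum_distrib_left mult_ac)
  finally show ?thesis .
qed

theorem theorem2p8:
  fixes M :: "'a measure" and Y :: "'a \<Rightarrow> real" and lam :: real and k :: int and n :: nat
  assumes "prob_space M"
    and "distributed M lborel Y (\<lambda>y. ennreal (if y \<ge> 0 then exp (- y) else 0))"
    and "lam \<noteq> 0"
    and "n \<ge> 1"
  shows "(\<forall>x::real. deg_poly_Bell M Y lam k n x =
            (\<Sum>m=1..n. \<Sum>l=m..n. deg_falling lam 1 m / real m powi (k - 1)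
               * lam ^ (n - l) * Lah l m * of_int (Stirling1 n l) * x ^ m))
       \<and> deg_poly_Bell_number M Y lam k n =
            (\<Sum>m=1..n. \<Sum>l=m..n. deg_falling lam 1 m / real m powi (k - 1)
               * lam ^ (n - l) * Lah l m * of_int (Stirling1 n l))"
  using deg_poly_Bell_exponential[OF assms, of k]
  by (simp add: deg_poly_Bell_number_def)

end
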